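(* Let $\gamma_1,\gamma_2$ be linearly independent functions on an interval such that $d(x,y):=\gamma_1(x)\gamma_2(y)-\gamma_1(y)\gamma_2(x)$ does not vanish for distinct $x,y$ in the interval, and let $1\in\mathrm{span}\{\gamma_1,\gamma_2\}$. Let $H(t)$ be a differentiable function and let $D^{-(n-m-1)}_{\gamma_1,\gamma_2}(H(t))$ denote the $(n-m-1)$-st antiderivative of $H(t)$. If $k=m-n<0$, then the extended non-polynomial homogeneous blossom $h$ of order $k$ of $H$ is given by $$h\big((x_1,w_1),\dots,(x_m,w_m)/(u_1,v_1),\dots,(u_n,v_n)\big)=\Big\{(n-m-1)!\,\Big(\prod_{i=1}^{m}\big(x_i\gamma_2(x)-w_i\gamma_1(x)\big)\Big)\,D^{-(n-m-1)}_{\gamma_1,\gamma_2}(H(x))\Big\}_{\gamma_1,\gamma_2}[\varepsilon_1,\dots,\varepsilon_n],$$ where $(u_i,v_i)=(\gamma_1(\varepsilon_i),\gamma_2(\varepsilon_i))$, $i=1,\dots,n$, and the divided difference is taken with respect to $x$.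
   Context: Generalized derivative: $D_{\gamma_1,\gamma_2}(f(x_0))=\lim_{x\to x_0}\dfrac{f(x)-f(x_0)}{d(x_0,x)}$, provided the limit exists; $D^{j}_{\gamma_1,\gamma_2}$ is its $j$-fold application. The $r$-th antiderivative $D^{-r}_{\gamma_1,\gamma_2}(H)$ is a function $A$ with $D^{r}_{\gamma_1,\gamma_2}A=H$ (for $r=0$, $A=H$). Non-polynomial divided difference: for distinct abscissas it is defined recursively by $f_{\gamma_1,\gamma_2}[x_k]=f(x_k)$ and $$f_{\gamma_1,\gamma_2}[x_j,\dots,x_{j+n}]=\frac{f_{\gamma_1,\gamma_2}[x_j,\dots,x_{j+n-2},x_{j+n}]-f_{\gamma_1,\gamma_2}[x_j,\dots,x_{j+n-1}]}{d(x_{j+n-1},x_{j+n})}.$$ When $1\in\mathrm{span}\{\gamma_1,\gamma_2\}$, the divided difference of a differentiable function (repeated nodes allowed) is characterized by: symmetry in the nodes; cancellation, $f(x)_{\gamma_1,\gamma_2}[x_0,\dots,x_n]=\{d(x_{n+1},x)f(x)\}_{\gamma_1,\gamma_2}[x_0,\dots,x_{n+1}]$; and differentiation, $f_{\gamma_1,\gamma_2}[x_0,\dots,x_0]=D^{n}_{\gamma_1,\gamma_2}f(x_0)/n!$ ($n+1$ equal nodes). Extended non-polynomial homogeneous blossom: the extended non-polynomial homogeneous blossom of order $k\in\mathbb{Z}$ of a function $H(x)$ is a function $h\big((x_1,w_1),\dots,(x_m,w_m)/(u_1,v_1),\dots,(u_n,v_n)\big)$ with $k=m-n$ (the same letter $h$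 being used for all $m,n$ with this difference) satisfying: (Bisymmetry) $h$ is invariant under permutations of the $(x,w)$ pairs and, separately, of the $(u,v)$ pairs; (Multilinearity) $h$ is linear in each pair $(x_i,w_i)$ separately; (Cancellation) $h\big((x_1,w_1),\dots,(x_m,w_m),(y,z)/(u_1,v_1),\dots,(u_n,v_n),(y,z)\big)=h\big((x_1,w_1),\dots,(x_m,w_m)/(u_1,v_1),\dots,(u_n,v_n)\big)$; (Diagonal) if all $m+n$ pairs equal $(\gamma_1(x),\gamma_2(x))$, the value of $h$ is $H(x)$.
   Formalization: γ1, γ2 are assumed continuous; H has generalized derivatives of all orders; the blossom axioms take (u,v) only on the curve (γ1,γ2); "is given by" means a blossom with this formula exists, for every antiderivative. Otherwise the divided difference or blossom is inconsistent or undefined. *)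

theory Defs
  imports "HOL-Analysis.Analysis" "HOL-Library.Multiset"
begin

definition gdet :: "(real \<Rightarrow> real) \<Rightarrow> (real \<Rightarrow> real) \<Rightarrow> real \<Rightarrow> real \<Rightarrow> real" where
  "gdet \<gamma>1 \<gamma>2 x y = \<gamma>1 x * \<gamma>2 y - \<gamma>1 y * \<gamma>2 x"

definition gquot :: "(real \<Rightarrow> real) \<Rightarrow> (real \<Rightarrow> real) \<Rightarrow> (real \<Rightarrow> real) \<Rightarrow> real \<Rightarrow> real \<Rightarrow> real" where
  "gquot \<gamma>1 \<gamma>2 f x0 x = (f x - f x0) / gdet \<gamma>1 \<gamma>2 x0 x"

text \<open>All limits are taken within the interval \<open>I\<close>, hence one-sided at an endpoint of \<open>I\<close>.
  Values outside \<open>I\<close> never matter.\<close>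

definition gderiv ::
  "real set \<Rightarrow> (real \<Rightarrow> real) \<Rightarrow> (real \<Rightarrow> real) \<Rightarrow> (real \<Rightarrow> real) \<Rightarrow> real \<Rightarrow> real" where
  "gderiv I \<gamma>1 \<gamma>2 f x0 = Lim (at x0 within I) (gquot \<gamma>1 \<gamma>2 f x0)"

definition gdifferentiable ::
  "real set \<Rightarrow> (real \<Rightarrow> real) \<Rightarrow> (real \<Rightarrow> real) \<Rightarrow> (real \<Rightarrow> real) \<Rightarrow> bool" where
  "gdifferentiable I \<gamma>1 \<gamma>2 f \<longleftrightarrow>
     (\<forall>x0\<in>I. \<exists>l. (gquot \<gamma>1 \<gamma>2 f x0 \<longlongrightarrow> l) (at x0 within I))"

text \<open>A differentiable function is one with generalized derivatives of every order on \<open>I\<close>: with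
  repeated nodes and arbitrarily many arguments, a blossom of a fixed order involves all of them.\<close>

definition gsmooth ::
  "real set \<Rightarrow> (real \<Rightarrow> real) \<Rightarrow> (real \<Rightarrow> real) \<Rightarrow> (real \<Rightarrow> real) \<Rightarrow> bool" where
  "gsmooth I \<gamma>1 \<gamma>2 f \<longleftrightarrow> (\<forall>j. gdifferentiable I \<gamma>1 \<gamma>2 ((gderiv I \<gamma>1 \<gamma>2 ^^ j) f))"

text \<open>\<open>A\<close> is an \<open>r\<close>-th antiderivative of \<open>H\<close>.\<close>

definition gantideriv ::
  "real set \<Rightarrow> (real \<Rightarrow> real) \<Rightarrow> (real \<Rightarrow> real) \<Rightarrow> nat \<Rightarrow> (real \<Rightarrow> real) \<Rightarrow> (real \<Rightarrow> real) \<Rightarrow> bool" where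
  "gantideriv I \<gamma>1 \<gamma>2 r H A \<longleftrightarrow>
     (\<forall>j<r. gdifferentiable I \<gamma>1 \<gamma>2 ((gderiv I \<gamma>1 \<gamma>2 ^^ j) A)) \<and>
     (\<forall>x\<in>I. (gderiv I \<gamma>1 \<gamma>2 ^^ r) A x = H x)"

text \<open>The recursion is imposed whenever its denominator does not vanish. On distinct nodes it is the
  definition of the divided difference of an arbitrary function; symmetry, cancellation
  and differentiation extend it to repeated nodes for functions that have all generalized
  derivatives. These clauses determine the value on every nonempty list of nodes in \<open>I\<close> for such
  functions: reorder the nodes so that the last two are distinct, or else all nodes are equal.\<close>

definition is_divided_difference ::
  "real set \<Rightarrow> (real \<Rightarrow> real) \<Rightarrow> (real \<Rightarrow> real) \<Rightarrow> ((real \<Rightarrow> real) \<Rightarrow> real list \<Rightarrow> real) \<Rightarrow> bool" where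
  "is_divided_difference I \<gamma>1 \<gamma>2 dd \<longleftrightarrow>
     (\<forall>f. \<forall>x\<in>I. dd f [x] = f x) \<and>
     (\<forall>f xs y z. set xs \<subseteq> I \<longrightarrow> y \<in> I \<longrightarrow> z \<in> I \<longrightarrow> y \<noteq> z \<longrightarrow>
        dd f (xs @ [y, z]) = (dd f (xs @ [z]) - dd f (xs @ [y])) / gdet \<gamma>1 \<gamma>2 y z) \<and>
     (\<forall>f xs ys. gsmooth I \<gamma>1 \<gamma>2 f \<longrightarrow> set xs \<subseteq> I \<longrightarrow> xs \<noteq> [] \<longrightarrow> mset ys = mset xs \<longrightarrow>
        dd f ys = dd f xs) \<and>
     (\<forall>f xs y. gsmooth I \<gamma>1 \<gamma>2 f \<longrightarrow> set xs \<subseteq> I \<longrightarrow> xs \<noteq> [] \<longrightarrow> y \<in> I \<longrightarrow>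
        dd (\<lambda>x. gdet \<gamma>1 \<gamma>2 y x * f x) (xs @ [y]) = dd f xs) \<and>
     (\<forall>f n. \<forall>x\<in>I. gsmooth I \<gamma>1 \<gamma>2 f \<longrightarrow>
        dd f (replicate (Suc n) x) = (gderiv I \<gamma>1 \<gamma>2 ^^ n) f x / fact n)"

definition divided_difference ::
  "real set \<Rightarrow> (real \<Rightarrow> real) \<Rightarrow> (real \<Rightarrow> real) \<Rightarrow> (real \<Rightarrow> real) \<Rightarrow> real list \<Rightarrow> real" where
  "divided_difference I \<gamma>1 \<gamma>2 = (SOME dd. is_divided_difference I \<gamma>1 \<gamma>2 dd)"

definition curve :: "(real \<Rightarrow> real) \<Rightarrow> (real \<Rightarrow> real) \<Rightarrow> real \<Rightarrow> real \<times> real" where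
  "curve \<gamma>1 \<gamma>2 x = (\<gamma>1 x, \<gamma>2 x)"

text \<open>\<open>h X U\<close> has the pairs \<open>(x, w)\<close> in the list \<open>X\<close> and the pairs \<open>(u, v)\<close> in the list \<open>U\<close>.
  The pairs \<open>(x, w)\<close> range over the whole plane, the pairs \<open>(u, v)\<close> over the curve: cancelling
  \<open>(0, 0)\<close>, for instance, would contradict multilinearity unless \<open>h = 0\<close>.\<close>

definition is_homogeneous_blossom ::
  "real set \<Rightarrow> (real \<Rightarrow> real) \<Rightarrow> (real \<Rightarrow> real) \<Rightarrow> int \<Rightarrow> (real \<Rightarrow> real) \<Rightarrow>
   ((real \<times> real) list \<Rightarrow> (real \<times> real) list \<Rightarrow> real) \<Rightarrow> bool" where
  "is_homogeneous_blossom I \<gamma>1 \<gamma>2 k H h \<longleftrightarrow>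
     (\<forall>X U X' U'. int (length X) - int (length U) = k \<longrightarrow> set U \<subseteq> curve \<gamma>1 \<gamma>2 ` I \<longrightarrow>
        mset X' = mset X \<longrightarrow> mset U' = mset U \<longrightarrow> h X' U' = h X U) \<and>
     (\<forall>X U i. int (length X) - int (length U) = k \<longrightarrow> set U \<subseteq> curve \<gamma>1 \<gamma>2 ` I \<longrightarrow>
        i < length X \<longrightarrow> linear (\<lambda>p. h (X[i := p]) U)) \<and>
     (\<forall>X U q. int (length X) - int (length U) = k \<longrightarrow> set U \<subseteq> curve \<gamma>1 \<gamma>2 ` I \<longrightarrow>
        q \<in> curve \<gamma>1 \<gamma>2 ` I \<longrightarrow> h (X @ [q]) (U @ [q]) = h X U) \<and>
     (\<forall>m n. int m - int n = k \<longrightarrow> (\<forall>x\<in>I.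
        h (replicate m (curve \<gamma>1 \<gamma>2 x)) (replicate n (curve \<gamma>1 \<gamma>2 x)) = H x))"

end

theory Submission
  imports Defs
begin

text \<open>If \<open>a \<gamma>1 + b \<gamma>2 = 1\<close>, then \<open>\<tau> = (a \<gamma>2 - b \<gamma>1) / (a\<^sup>2 + b\<^sup>2)\<close> satisfies
  \<open>d(x, y) = \<tau>(y) - \<tau>(x)\<close>, and \<open>\<gamma>1\<close>, \<open>\<gamma>2\<close> are affine in \<open>\<tau>\<close>. So \<open>\<tau>\<close> is a homeomorphism of
  \<open>I\<close> onto an interval, the generalized derivative is the ordinary derivative with respect to \<open>\<tau>\<close>,
  and the generalized divided difference is the ordinary one in the coordinate \<open>\<tau>\<close>. For a smooth
  \<open>F\<close> of this coordinate,
  \<open>(F(s) - F(t)) / (s - t) = \<integral>\<^sub>0\<^sup>1 F'(t + u (s - t)) du\<close>; differentiating under the integral shows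
  that slopes of smooth functions are smooth and yields their derivatives at \<open>t\<close>. Iterated slopes
  therefore give a divided difference with repeated nodes, and its characterizing properties
  determine it on smooth functions. In the formula for \<open>h\<close>, a factor belonging to a pair
  \<open>(\<gamma>1 y, \<gamma>2 y)\<close> is \<open>d(y, x)\<close>, so cancellation for the blossom is cancellation for the divided
  difference, and the diagonal property is its differentiation property.\<close>

section \<open>Means along segments\<close>

text \<open>A smooth function with all its derivatives carried as one sequence: \<open>F 0\<close>
  is the function, \<open>F j\<close> its \<open>j\<close>-th derivative, one-sided at endpoints of
  \<open>J\<close>.\<close>

definition deriv_seq :: "real set \<Rightarrow> (nat \<Rightarrow> real \<Rightarrow> real) \<Rightarrow> bool" where
  "deriv_seq J F \<longleftrightarrow> (\<forall>j. \<forall>t\<in>J. (F j has_real_derivative F (Suc j) t) (at t within J))"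

lemma deriv_seqD:
  "deriv_seq J F \<Longrightarrow> t \<in> J \<Longrightarrow> (F j has_real_derivative F (Suc j) t) (at t within J)"
  by (simp add: deriv_seq_def)

lemma deriv_seq_continuous_on: "deriv_seq J F \<Longrightarrow> continuous_on J (F j)"
  by (meson DERIV_continuous_on deriv_seqD)

text \<open>For \<open>n = 0\<close> and \<open>G\<close> the derivative of \<open>F\<close>, this
  is the slope of \<open>F\<close> between \<open>c\<close> and \<open>s\<close>; the weight
  \<open>u ^ n\<close> appears after \<open>n\<close> differentiations in \<open>s\<close>.\<close>

definition radial_mean :: "(real \<Rightarrow> real) \<Rightarrow> nat \<Rightarrow> real \<Rightarrow> real \<Rightarrow> real" where
  "radial_mean G n c s = integral {0..1} (\<lambda>u. u ^ n * G (c + u * (s - c)))"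

lemma segment_in_convex:
  fixes c s u :: real
  assumes "convex J" "c \<in> J" "s \<in> J" "u \<in> {0..1}"
  shows "c + u * (s - c) \<in> J"
proof -
  have "(1 - u) *\<^sub>R c + u *\<^sub>R s \<in> J"
    using assms by (intro convexD) auto
  then show ?thesis by (simp add: algebra_simps)
qed

lemma continuous_on_radial:
  assumes "convex J" "c \<in> J" "s \<in> J" "continuous_on J G"
  shows "continuous_on {0..1} (\<lambda>u::real. u ^ n * G (c + u * (s - c)))"
  using segment_in_convex[OF assms(1-3)]
  by (intro continuous_intros continuous_on_compose2[OF assms(4)]) auto

text \<open>At the centre only the integral of \<open>u ^ n\<close> remains. These factors
  \<open>1 / (n + 1)\<close> later build up the factorial in the differentiation property.\<close>

lemma radial_mean_at_center: "radial_mean G n c c = G c / (real n + 1)"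
proof -
  have "((\<lambda>u::real. u ^ n) has_integral (1 ^ Suc n / (real n + 1) - 0 ^ Suc n / (real n + 1))) {0..1}"
  proof (rule fundamental_theorem_of_calculus)
    fix x :: real
    have "real n + 1 \<noteq> 0" by linarith
    then have "((\<lambda>u. u ^ Suc n / (real n + 1)) has_real_derivative x ^ n) (at x within {0..1})"
      using DERIV_cdivide[OF DERIV_pow[of "Suc n" x "{0..1}"], of "real n + 1"]
      by (simp add: add.commute)
    then show "((\<lambda>u. u ^ Suc n / (real n + 1)) has_vector_derivative x ^ n) (at x within {0..1})"
      by (simp add: has_real_derivative_iff_has_vector_derivative)
  qed simp
  from has_integral_mult_left[OF this, of "G c"] show ?thesis
    unfolding radial_mean_def by (intro integral_unique) simp
qed

text \<open>Differentiation under the integral sign; the chain rule contributes one more factor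
  \<open>u\<close>.\<close>

lemma radial_mean_has_derivative:
  assumes J: "convex J" "c \<in> J" "s \<in> J"
    and G: "\<And>t. t \<in> J \<Longrightarrow> (G has_real_derivative G' t) (at t within J)"
    and G': "continuous_on J G'"
  shows "(radial_mean G n c has_real_derivative radial_mean G' (Suc n) c s) (at s within J)"
proof -
  have seg: "c + u * (x - c) \<in> J" if "x \<in> J" "u \<in> {0..1}" for x u
    using segment_in_convex[OF J(1,2)] that by blast
  have "((\<lambda>x. integral (cbox 0 1) (\<lambda>u. u ^ n * G (c + u * (x - c)))) has_real_derivative
      integral (cbox 0 1) (\<lambda>u. u ^ Suc n * G' (c + u * (s - c)))) (at s within J)"
  proof (rule leibniz_rule_field_derivative)
    fix x u :: real assume x: "x \<in> J" and u: "u \<in> cbox 0 1"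
    have "((\<lambda>x. G (c + u * (x - c))) has_real_derivative G' (c + u * (x - c)) * u) (at x within J)"
    proof (rule DERIV_image_chain[unfolded o_def, OF DERIV_subset[OF G]])
      show "((\<lambda>x. c + u * (x - c)) has_real_derivative u) (at x within J)"
        by (rule derivative_eq_intros refl | simp)+
    qed (use seg x u in auto)
    then show "((\<lambda>x. u ^ n * G (c + u * (x - c))) has_real_derivative
        u ^ Suc n * G' (c + u * (x - c))) (at x within J)"
      by (auto intro!: derivative_eq_intros)
  next
    fix x assume "x \<in> J"
    then show "(\<lambda>u. u ^ n * G (c + u * (x - c))) integrable_on cbox 0 1"
      using continuous_on_radial[OF J(1,2) _ DERIV_continuous_on[OF G]]
      by (auto intro: integrable_continuous_interval)
  next
    show "continuous_on (J \<times> cbox 0 1) (\<lambda>(x, u). u ^ Suc n * G' (c + u * (x - c)))"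
      unfolding split_beta using seg
      by (intro continuous_intros continuous_on_compose2[OF G']) auto
  qed (use J in auto)
  then show ?thesis
    unfolding radial_mean_def by simp
qed

text \<open>Integration of the derivative of \<^term>\<open>\<lambda>u. u ^ n * G (c + u * (s - c))\<close> over \<open>[0, 1]\<close>.\<close>

lemma radial_mean_by_parts:
  assumes J: "convex J" "c \<in> J" "s \<in> J"
    and G: "\<And>t. t \<in> J \<Longrightarrow> (G has_real_derivative G' t) (at t within J)"
    and G': "continuous_on J G'"
  shows "(s - c) * radial_mean G' n c s + real n * radial_mean G (n - 1) c s = G s - 0 ^ n * G c"
proof -
  have "((\<lambda>u. (s - c) * (u ^ n * G' (c + u * (s - c))) + real n * (u ^ (n - 1) * G (c + u * (s - c))))
     has_integral (1 ^ n * G (c + 1 * (s - c)) - 0 ^ n * G (c + 0 * (s - c)))) {0..1}"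
  proof (rule fundamental_theorem_of_calculus)
    fix u :: real assume u: "u \<in> {0..1}"
    have "((\<lambda>u. G (c + u * (s - c))) has_real_derivative G' (c + u * (s - c)) * (s - c)) (at u within {0..1})"
    proof (rule DERIV_image_chain[unfolded o_def, OF DERIV_subset[OF G]])
      show "((\<lambda>u. c + u * (s - c)) has_real_derivative s - c) (at u within {0..1})"
        by (rule derivative_eq_intros refl | simp)+
    qed (use segment_in_convex[OF J] u in auto)
    then have "((\<lambda>u. u ^ n * G (c + u * (s - c))) has_real_derivative
       (s - c) * (u ^ n * G' (c + u * (s - c))) + real n * (u ^ (n - 1) * G (c + u * (s - c))))
       (at u within {0..1})"
      by (auto intro!: derivative_eq_intros)
    then show "((\<lambda>u. u ^ n * G (c + u * (s - c))) has_vector_derivative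
       (s - c) * (u ^ n * G' (c + u * (s - c))) + real n * (u ^ (n - 1) * G (c + u * (s - c))))
       (at u within {0..1})"
      by (simp add: has_real_derivative_iff_has_vector_derivative)
  qed simp
  moreover have "((\<lambda>u. (s - c) * (u ^ n * G' (c + u * (s - c))) +
      real n * (u ^ (n - 1) * G (c + u * (s - c))))
     has_integral ((s - c) * radial_mean G' n c s + real n * radial_mean G (n - 1) c s)) {0..1}"
    unfolding radial_mean_def
    using continuous_on_radial[OF J G'] continuous_on_radial[OF J DERIV_continuous_on[OF G]]
    by (intro has_integral_add has_integral_mult_right integrable_integral
        integrable_continuous_interval)
  ultimately show ?thesis
    by (auto dest: has_integral_unique)
qed

text \<open>Each differentiation raises the order of \<open>F\<close> and the exponent of the weight
  together. For \<open>k = 1\<close> the sequence starts with the slope function of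
  \<open>F 0\<close> at \<open>c\<close>.\<close>

lemma deriv_seq_radial_mean:
  assumes "convex J" "c \<in> J" "deriv_seq J F"
  shows "deriv_seq J (\<lambda>n. radial_mean (F (n + k)) n c)"
  unfolding deriv_seq_def
  using radial_mean_has_derivative[OF assms(1,2) _ deriv_seqD[OF assms(3)]
      deriv_seq_continuous_on[OF assms(3)]] by simp

section \<open>Antiderivatives of smooth functions\<close>

lemma deriv_seq_antiderivative:
  assumes "convex J" "deriv_seq J F"
  obtains F' where "deriv_seq J F'" "\<And>j. F' (Suc j) = F j"
proof (cases "J = {}")
  case True
  then show ?thesis
    using that[of "\<lambda>j. F (j - 1)"] by (simp add: deriv_seq_def)
next
  case False
  then obtain c where c: "c \<in> J" by blast
  \<comment> \<open>The integral of \<open>F 0\<close> from \<open>c\<close> to \<open>s\<close>,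
    written as length times mean so that the lemmas on means apply.\<close>
  define F' where "F' = case_nat (\<lambda>s. (s - c) * radial_mean (F 0) 0 c s) F"
  have "((\<lambda>s. (s - c) * radial_mean (F 0) 0 c s) has_real_derivative F 0 s) (at s within J)"
    if s: "s \<in> J" for s
  proof -
    have F: "\<And>t. t \<in> J \<Longrightarrow> (F 0 has_real_derivative F (Suc 0) t) (at t within J)"
      using deriv_seqD[OF assms(2)] .
    note F' = deriv_seq_continuous_on[OF assms(2)]
    have "((\<lambda>s. (s - c) * radial_mean (F 0) 0 c s) has_real_derivative
        (s - c) * radial_mean (F 1) 1 c s + radial_mean (F 0) 0 c s) (at s within J)"
      using radial_mean_has_derivative[OF assms(1) c s F F', of 0]
      by (auto intro!: derivative_eq_intros)
    \<comment> \<open>Weight exponent 1 makes the boundary term at \<open>c\<close> vanish.\<close>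
    also have "(s - c) * radial_mean (F 1) 1 c s + radial_mean (F 0) 0 c s = F 0 s"
      using radial_mean_by_parts[OF assms(1) c s F F', of 1] by simp
    finally show ?thesis .
  qed
  then have "deriv_seq J F'"
    unfolding deriv_seq_def F'_def using deriv_seqD[OF assms(2)] by (auto split: nat.split)
  then show ?thesis
    using that by (simp add: F'_def)
qed

lemma deriv_seq_iterated_antiderivative:
  assumes "convex J" "deriv_seq J F"
  shows "\<exists>F'. deriv_seq J F' \<and> F' r = F 0"
proof -
  \<comment> \<open>The induction needs agreement with the whole sequence shifted by
    \<open>r\<close>, not only at order \<open>r\<close>.\<close>
  have "\<exists>F'. deriv_seq J F' \<and> (\<forall>j. F' (j + r) = F j)"
  proof (induction r)
    case 0
    then show ?case using assms(2) by auto
  next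
    case (Suc r)
    then obtain F' where F': "deriv_seq J F'" "\<forall>j. F' (j + r) = F j" by blast
    obtain F'' where "deriv_seq J F''" "\<And>j. F'' (Suc j) = F' j"
      by (rule deriv_seq_antiderivative[OF assms(1) F'(1)]) blast
    with F'(2) show ?case by auto
  qed
  then show ?thesis by (metis add_0)
qed

section \<open>Generalized derivatives and divided differences in a chart\<close>

lemma gdet_swap: "gdet \<gamma>1 \<gamma>2 y x = - gdet \<gamma>1 \<gamma>2 x y"
  by (simp add: gdet_def)

definition gslope ::
  "real set \<Rightarrow> (real \<Rightarrow> real) \<Rightarrow> (real \<Rightarrow> real) \<Rightarrow> real \<Rightarrow> (real \<Rightarrow> real) \<Rightarrow> real \<Rightarrow> real" where
  "gslope I \<gamma>1 \<gamma>2 x f y = (if y = x then gderiv I \<gamma>1 \<gamma>2 f x else gquot \<gamma>1 \<gamma>2 f x y)"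

text \<open>Since the divided difference with \<open>x\<close> prepended to the nodes is the divided difference of
  the slope function at \<open>x\<close>, and slopes are defined at the node itself by the derivative, folding
  the slope operator handles repeated nodes without a limit over nodes.\<close>

definition slope_diff ::
  "real set \<Rightarrow> (real \<Rightarrow> real) \<Rightarrow> (real \<Rightarrow> real) \<Rightarrow> (real \<Rightarrow> real) \<Rightarrow> real list \<Rightarrow> real" where
  "slope_diff I \<gamma>1 \<gamma>2 f xs = fold (gslope I \<gamma>1 \<gamma>2) (butlast xs) f (last xs)"

lemma slope_diff_single [simp]: "slope_diff I \<gamma>1 \<gamma>2 f [x] = f x"
  by (simp add: slope_diff_def)

lemma slope_diff_Cons:
  "xs \<noteq> [] \<Longrightarrow> slope_diff I \<gamma>1 \<gamma>2 f (x # xs) = slope_diff I \<gamma>1 \<gamma>2 (gslope I \<gamma>1 \<gamma>2 x f) xs"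
  by (simp add: slope_diff_def)

text \<open>The operator folded last is the slope at \<open>y\<close>; evaluated at
  \<open>z\<close>, away from its node, it is the plain quotient.\<close>

lemma slope_diff_recursion:
  "y \<noteq> z \<Longrightarrow> slope_diff I \<gamma>1 \<gamma>2 f (xs @ [y, z]) =
     (slope_diff I \<gamma>1 \<gamma>2 f (xs @ [z]) - slope_diff I \<gamma>1 \<gamma>2 f (xs @ [y])) / gdet \<gamma>1 \<gamma>2 y z"
  by (simp add: slope_diff_def butlast_append gslope_def gquot_def)

lemma gderiv_cong:
  assumes "\<And>x. x \<in> I \<Longrightarrow> f x = g x" "x0 \<in> I"
  shows "gderiv I \<gamma>1 \<gamma>2 f x0 = gderiv I \<gamma>1 \<gamma>2 g x0"
proof -
  \<comment> \<open>\<open>Lim\<close> is a definite description over the limits, so having the same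
    limits suffices, even if none exists.\<close>
  have "(gquot \<gamma>1 \<gamma>2 f x0 \<longlongrightarrow> l) (at x0 within I) \<longleftrightarrow> (gquot \<gamma>1 \<gamma>2 g x0 \<longlongrightarrow> l) (at x0 within I)" for l
    by (rule tendsto_cong) (simp add: eventually_at_topological gquot_def assms, blast)
  then show ?thesis
    by (simp add: gderiv_def Topological_Spaces.Lim_def)
qed

lemma gslope_cong:
  assumes "\<And>x. x \<in> I \<Longrightarrow> f x = g x" "x \<in> I" "y \<in> I"
  shows "gslope I \<gamma>1 \<gamma>2 x f y = gslope I \<gamma>1 \<gamma>2 x g y"
  using assms gderiv_cong[OF assms(1,2)] by (simp add: gslope_def gquot_def)

lemma slope_diff_cong:
  assumes "\<And>x. x \<in> I \<Longrightarrow> f x = g x" "set xs \<subseteq> I" "xs \<noteq> []"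
  shows "slope_diff I \<gamma>1 \<gamma>2 f xs = slope_diff I \<gamma>1 \<gamma>2 g xs"
  using assms
proof (induction xs arbitrary: f g)
  case (Cons x xs)
  show ?case
  proof (cases "xs = []")
    case False
    then show ?thesis
      using Cons.prems gslope_cong[OF Cons.prems(1)] by (auto simp: slope_diff_Cons intro!: Cons.IH)
  qed (use Cons.prems in simp)
qed simp

section \<open>The coordinate in which generalized derivatives are ordinary ones\<close>

text \<open>The determinant of the affine coefficients is normalised to 1 so that
  \<open>gdet\<close> is exactly the difference of coordinates. Excluding singletons makes every
  point of \<open>I\<close> a limit point of \<open>I\<close>, hence limits unique.\<close>

locale chart =
  fixes I :: "real set" and \<gamma>1 \<gamma>2 \<tau> :: "real \<Rightarrow> real" and a1 b1 a2 b2 :: real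
  assumes interval: "is_interval I"
    and nontrivial: "I \<noteq> {x}"
    and cont: "continuous_on I \<tau>"
    and inj: "inj_on \<tau> I"
    and gamma1: "x \<in> I \<Longrightarrow> \<gamma>1 x = a1 + b1 * \<tau> x"
    and gamma2: "x \<in> I \<Longrightarrow> \<gamma>2 x = a2 + b2 * \<tau> x"
    and unimodular: "a1 * b2 - a2 * b1 = 1"
begin

abbreviation J :: "real set" where "J \<equiv> \<tau> ` I"
abbreviation D :: "(real \<Rightarrow> real) \<Rightarrow> real \<Rightarrow> real" where "D \<equiv> gderiv I \<gamma>1 \<gamma>2"
abbreviation slope :: "real \<Rightarrow> (real \<Rightarrow> real) \<Rightarrow> real \<Rightarrow> real" where "slope \<equiv> gslope I \<gamma>1 \<gamma>2"
abbreviation smooth :: "(real \<Rightarrow> real) \<Rightarrow> bool" where "smooth \<equiv> gsmooth I \<gamma>1 \<gamma>2"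
abbreviation sdiff :: "(real \<Rightarrow> real) \<Rightarrow> real list \<Rightarrow> real" where "sdiff \<equiv> slope_diff I \<gamma>1 \<gamma>2"

lemma gdet_eq:
  assumes "x \<in> I" "y \<in> I"
  shows "gdet \<gamma>1 \<gamma>2 x y = \<tau> y - \<tau> x"
proof -
  have "gdet \<gamma>1 \<gamma>2 x y = (a1 * b2 - a2 * b1) * (\<tau> y - \<tau> x)"
    using assms by (simp add: gdet_def gamma1 gamma2 algebra_simps)
  then show ?thesis by (simp add: unimodular)
qed

lemma connected_I: "connected I"
  using interval by (simp add: is_interval_connected)

lemma islimpt_I: "x \<in> I \<Longrightarrow> x islimpt I"
  using connected_imp_perfect[OF connected_I] nontrivial by blast

lemma at_within_I [simp]: "x \<in> I \<Longrightarrow> at x within I \<noteq> bot"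
  using islimpt_I by (simp add: trivial_limit_within)

lemma convex_J: "convex J"
  using connected_continuous_image[OF cont connected_I]
  by (simp add: is_interval_connected_1[symmetric] is_interval_convex)

text \<open>A continuous injection on an interval is a homeomorphism onto its image, so limits at
  \<open>x0\<close> within \<open>I\<close> can be traded for limits at \<open>\<tau> x0\<close>
  within \<open>J\<close>.\<close>

lemma filtermap_chart:
  assumes "x0 \<in> I"
  shows "filtermap \<tau> (at x0 within I) = at (\<tau> x0) within J"
proof -
  obtain \<sigma> where \<sigma>: "homeomorphism I J \<tau> \<sigma>"
    using homeomorphism_into_1d[OF _ cont refl inj] interval
    by (auto simp: is_interval_path_connected)
  show ?thesis
  proof (rule filtermap_fun_inverse)
    show "filterlim \<sigma> (at x0 within I) (at (\<tau> x0) within J)"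
    proof (rule filterlim_at_withinI)
      have "(\<sigma> \<longlongrightarrow> \<sigma> (\<tau> x0)) (at (\<tau> x0) within J)"
        using homeomorphism_cont2[OF \<sigma>] assms by (auto simp: continuous_on)
      then show "(\<sigma> \<longlongrightarrow> x0) (at (\<tau> x0) within J)"
        using homeomorphism_apply1[OF \<sigma> assms] by simp
      show "\<forall>\<^sub>F t in at (\<tau> x0) within J. \<sigma> t \<in> I - {x0}"
        unfolding eventually_at_filter
        using homeomorphism_apply1[OF \<sigma>] by (intro always_eventually) auto
    qed
    show "filterlim \<tau> (at (\<tau> x0) within J) (at x0 within I)"
    proof (rule filterlim_at_withinI)
      show "(\<tau> \<longlongrightarrow> \<tau> x0) (at x0 within I)"
        using cont assms by (auto simp: continuous_on)
      show "\<forall>\<^sub>F x in at x0 within I. \<tau> x \<in> J - {\<tau> x0}"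
        unfolding eventually_at_filter
        using inj_onD[OF inj] assms by (intro always_eventually) blast
    qed
    show "\<forall>\<^sub>F t in at (\<tau> x0) within J. \<tau> (\<sigma> t) = t"
      unfolding eventually_at_filter
      using homeomorphism_apply2[OF \<sigma>] by (intro always_eventually) blast
  qed
qed

text \<open>Since \<open>gdet\<close> is a difference of coordinates, \<open>gquot\<close> is the
  ordinary difference quotient of \<open>F\<close>, transported by \<open>\<tau>\<close>.\<close>

lemma tendsto_gquot_iff:
  assumes f: "\<And>x. x \<in> I \<Longrightarrow> f x = F (\<tau> x)" and x0: "x0 \<in> I"
  shows "(gquot \<gamma>1 \<gamma>2 f x0 \<longlongrightarrow> l) (at x0 within I) \<longleftrightarrow>
    (F has_real_derivative l) (at (\<tau> x0) within J)"
proof -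
  have "(F has_real_derivative l) (at (\<tau> x0) within J) \<longleftrightarrow>
    ((\<lambda>x. (F (\<tau> x) - F (\<tau> x0)) / (\<tau> x - \<tau> x0)) \<longlongrightarrow> l) (at x0 within I)"
    unfolding has_field_derivative_iff
    unfolding filtermap_chart[OF x0, symmetric]
    by (simp add: filterlim_filtermap)
  also have "\<dots> \<longleftrightarrow> (gquot \<gamma>1 \<gamma>2 f x0 \<longlongrightarrow> l) (at x0 within I)"
    by (rule tendsto_cong)
       (use x0 in \<open>auto simp: eventually_at_filter gquot_def f gdet_eq intro!: always_eventually\<close>)
  finally show ?thesis ..
qed

lemma gderiv_eq:
  assumes f: "\<And>x. x \<in> I \<Longrightarrow> f x = F (\<tau> x)" and x0: "x0 \<in> I"
    and F: "(F has_real_derivative l) (at (\<tau> x0) within J)"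
  shows "D f x0 = l"
  unfolding gderiv_def using F x0 tendsto_gquot_iff[of f F x0 l] f by (intro tendsto_Lim) auto

section \<open>Smooth functions as jets in the coordinate\<close>

text \<open>\<^term>\<open>jet f F\<close>: \<open>F j\<close> is the \<open>j\<close>-th generalized derivative of \<open>f\<close>, read in the
  coordinate \<open>\<tau>\<close>.\<close>

definition jet :: "(real \<Rightarrow> real) \<Rightarrow> (nat \<Rightarrow> real \<Rightarrow> real) \<Rightarrow> bool" where
  "jet f F \<longleftrightarrow> deriv_seq J F \<and> (\<forall>x\<in>I. f x = F 0 (\<tau> x))"

lemma jet_cong: "jet f F \<Longrightarrow> (\<And>x. x \<in> I \<Longrightarrow> g x = f x) \<Longrightarrow> jet g F"
  by (simp add: jet_def)

lemma jet_gderiv_gdifferentiable: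
  assumes "jet f F"
  shows "x \<in> I \<Longrightarrow> (D ^^ j) f x = F j (\<tau> x)" "gdifferentiable I \<gamma>1 \<gamma>2 ((D ^^ j) f)"
proof -
  have F: "(F j has_real_derivative F (Suc j) (\<tau> x)) (at (\<tau> x) within J)" if "x \<in> I" for x j
    using assms deriv_seqD that by (auto simp: jet_def)
  have *: "\<forall>x\<in>I. (D ^^ j) f x = F j (\<tau> x)" for j
  proof (induction j)
    case (Suc j)
    then show ?case
      using gderiv_eq[of "(D ^^ j) f" "F j"] F by simp
  qed (use assms in \<open>simp add: jet_def\<close>)
  then show "x \<in> I \<Longrightarrow> (D ^^ j) f x = F j (\<tau> x)" by blast
  show "gdifferentiable I \<gamma>1 \<gamma>2 ((D ^^ j) f)"
    unfolding gdifferentiable_def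
    using tendsto_gquot_iff[of "(D ^^ j) f" "F j"] * F by blast
qed

lemmas jet_gderiv = jet_gderiv_gdifferentiable(1)

lemma jet_gsmooth: "jet f F \<Longrightarrow> smooth f"
  by (simp add: gsmooth_def jet_gderiv_gdifferentiable(2))

lemma gsmooth_jet:
  assumes "smooth f"
  shows "\<exists>F. jet f F"
proof -
  \<comment> \<open>The generalized derivatives composed with the inverse of the coordinate.\<close>
  define F where "F j t = (D ^^ j) f (inv_into I \<tau> t)" for j t
  have F: "(D ^^ j) f x = F j (\<tau> x)" if "x \<in> I" for j x
    using that inj by (simp add: F_def)
  have "(F j has_real_derivative F (Suc j) (\<tau> x)) (at (\<tau> x) within J)" if x: "x \<in> I" for j x
  proof -
    obtain l where l: "(F j has_real_derivative l) (at (\<tau> x) within J)"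
      using assms x tendsto_gquot_iff[of "(D ^^ j) f" "F j", OF F x]
      unfolding gsmooth_def gdifferentiable_def by metis
    have "F (Suc j) (\<tau> x) = l"
      using F[OF x, of "Suc j"] gderiv_eq[of "(D ^^ j) f" "F j", OF F x l] by simp
    with l show ?thesis by simp
  qed
  then have "jet f F"
    using F[of _ 0] by (auto simp: jet_def deriv_seq_def)
  then show ?thesis by blast
qed

lemma jet_add_scaled:
  assumes "jet f F" "jet g G"
  shows "jet (\<lambda>x. c * f x + d * g x) (\<lambda>j t. c * F j t + d * G j t)"
  using assms unfolding jet_def deriv_seq_def by (auto intro!: derivative_eq_intros)

text \<open>The Leibniz rule stops after two terms because the second derivative of an affine factor
  is zero. At \<open>j = 0\<close> the coefficient kills the term with the truncated index
  \<open>j - 1\<close>.\<close>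

lemma jet_affine_mult:
  assumes f: "jet f F" and l: "\<And>x. x \<in> I \<Longrightarrow> l x = a + b * \<tau> x"
  shows "jet (\<lambda>x. l x * f x) (\<lambda>j t. (a + b * t) * F j t + real j * b * F (j - 1) t)"
proof -
  have F: "(F j has_real_derivative F (Suc j) t) (at t within J)" if "t \<in> J" for j t
    using f deriv_seqD that by (auto simp: jet_def)
  have "((\<lambda>t. (a + b * t) * F j t + real j * b * F (j - 1) t) has_real_derivative
      (a + b * t) * F (Suc j) t + real (Suc j) * b * F (Suc j - 1) t) (at t within J)"
    if "t \<in> J" for j t
    using F[OF that, of j] F[OF that, of "j - 1"]
    by (cases j) (auto intro!: derivative_eq_intros simp: algebra_simps)
  then show ?thesis
    using f l by (auto simp: jet_def deriv_seq_def)
qed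

text \<open>Off the node, integration by parts with \<open>n = 0\<close> is the fundamental theorem
  of calculus; at the node both sides are the first derivative.\<close>

lemma jet_slope:
  assumes f: "jet f F" and x: "x \<in> I"
  shows "jet (slope x f) (\<lambda>n. radial_mean (F (Suc n)) n (\<tau> x))"
proof -
  have J: "convex J" "\<tau> x \<in> J" and F: "deriv_seq J F"
    using f x convex_J by (auto simp: jet_def)
  have "slope x f y = radial_mean (F 1) 0 (\<tau> x) (\<tau> y)" if y: "y \<in> I" for y
  proof (cases "y = x")
    case True
    then show ?thesis
      using jet_gderiv[OF f x, of 1] by (simp add: gslope_def radial_mean_at_center)
  next
    case False
    then have "\<tau> y \<noteq> \<tau> x" using inj x y by (auto dest: inj_onD)
    moreover have "(\<tau> y - \<tau> x) * radial_mean (F 1) 0 (\<tau> x) (\<tau> y) = F 0 (\<tau> y) - F 0 (\<tau> x)"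
      using radial_mean_by_parts[OF J, of "\<tau> y" "F 0" "F 1" 0]
        deriv_seqD[OF F] deriv_seq_continuous_on[OF F] y by simp
    ultimately show ?thesis
      using False f x y by (simp add: gslope_def gquot_def gdet_eq jet_def field_simps)
  qed
  then show ?thesis
    using deriv_seq_radial_mean[OF J F, of 1] by (simp add: jet_def)
qed

lemma gsmooth_iff_jet: "smooth f \<longleftrightarrow> (\<exists>F. jet f F)"
  using gsmooth_jet jet_gsmooth by blast

lemma smooth_slope: "smooth f \<Longrightarrow> x \<in> I \<Longrightarrow> smooth (slope x f)"
  unfolding gsmooth_iff_jet by (elim exE, rule exI, rule jet_slope)

lemma smooth_add_scaled: "smooth f \<Longrightarrow> smooth g \<Longrightarrow> smooth (\<lambda>x. c * f x + d * g x)"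
  unfolding gsmooth_iff_jet by (elim exE, rule exI, rule jet_add_scaled)

lemma smooth_affine_mult:
  "smooth f \<Longrightarrow> (\<And>x. x \<in> I \<Longrightarrow> l x = a + b * \<tau> x) \<Longrightarrow> smooth (\<lambda>x. l x * f x)"
  unfolding gsmooth_iff_jet by (elim exE, rule exI, rule jet_affine_mult)

lemma smooth_cong: "smooth f \<Longrightarrow> (\<And>x. x \<in> I \<Longrightarrow> g x = f x) \<Longrightarrow> smooth g"
  unfolding gsmooth_iff_jet by (elim exE, rule exI, rule jet_cong)

lemma smooth_continuous_on: "smooth f \<Longrightarrow> continuous_on I f"
proof -
  assume "smooth f"
  then obtain F where F: "jet f F" using gsmooth_jet by blast
  then have "continuous_on I (\<lambda>x. F 0 (\<tau> x))"
    by (intro continuous_on_compose2[OF deriv_seq_continuous_on cont]) (auto simp: jet_def)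
  then show ?thesis
    using F by (simp add: jet_def)
qed

section \<open>Symmetry of iterated slopes\<close>

text \<open>Both sides are the second divided difference of values \<open>a\<close>,
  \<open>b\<close>, \<open>c\<close> at \<open>u\<close>, \<open>v\<close>, \<open>w\<close>. They
  share the slope \<open>m\<close> between \<open>u\<close> and \<open>v\<close>, and eliminating
  \<open>a\<close> through \<open>m\<close> makes the numerators agree.\<close>

lemma second_slope_commute:
  fixes a b c u v w :: real
  assumes "u \<noteq> v" "w \<noteq> u" "w \<noteq> v"
  shows "((c - b) / (w - v) - (a - b) / (u - v)) / (w - u) =
    ((c - a) / (w - u) - (b - a) / (v - u)) / (w - v)"
proof -
  define m where "m = (a - b) / (u - v)"
  have m: "(b - a) / (v - u) = m"
    unfolding m_def by (metis minus_diff_eq minus_divide_divide)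
  have "m * (u - v) = a - b"
    using assms by (simp add: m_def)
  then have a: "a = b + m * (u - v)" by simp
  have "((c - b) / (w - v) - m) / (w - u) = (c - b - m * (w - v)) / ((w - v) * (w - u))"
    using assms by (simp add: diff_divide_distrib flip: divide_divide_eq_left)
  also have "\<dots> = (c - a - m * (w - u)) / ((w - u) * (w - v))"
    by (simp add: a algebra_simps)
  also have "\<dots> = ((c - a) / (w - u) - m) / (w - v)"
    using assms by (simp add: diff_divide_distrib flip: divide_divide_eq_left)
  finally show ?thesis
    unfolding m m_def .
qed

lemma slope_sym: "x \<in> I \<Longrightarrow> y \<in> I \<Longrightarrow> slope x f y = slope y f x"
  unfolding gslope_def gquot_def gdet_swap[of \<gamma>1 \<gamma>2 y x]
  by (metis minus_diff_eq minus_divide_divide)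

text \<open>For three distinct points the identity is algebraic; coinciding points are reached by
  continuity, because no point of \<open>I\<close> is isolated.\<close>

lemma slope_commute:
  assumes f: "smooth f" and x: "x \<in> I" and y: "y \<in> I" and z: "z \<in> I"
  shows "slope x (slope y f) z = slope y (slope x f) z"
proof (cases "x = y")
  case False
  let ?p = "slope x (slope y f)" and ?q = "slope y (slope x f)"
  have distinct: "?p w = ?q w" if w: "w \<in> I" "w \<noteq> x" "w \<noteq> y" for w
  proof -
    have "\<tau> x \<noteq> \<tau> y" "\<tau> w \<noteq> \<tau> x" "\<tau> w \<noteq> \<tau> y"
      using inj False x y w by (auto dest: inj_onD)
    then show ?thesis
      using w False x y second_slope_commute[of "\<tau> x" "\<tau> y" "\<tau> w" "f w" "f y" "f x"]
      by (simp add: gslope_def gquot_def gdet_eq)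
  qed
  have "\<forall>\<^sub>F w in at z within I. w \<in> I"
    by (simp add: eventually_at_filter)
  then have eq: "\<forall>\<^sub>F w in at z within I. ?p w = ?q w"
    using eventually_neq_at_within[of x z I] eventually_neq_at_within[of y z I]
    by eventually_elim (use distinct in auto)
  have "(?p \<longlongrightarrow> ?p z) (at z within I)" "(?q \<longlongrightarrow> ?q z) (at z within I)"
    using smooth_continuous_on[OF smooth_slope[OF smooth_slope[OF f]]] x y z
    by (simp_all add: continuous_on)
  then show ?thesis
    unfolding tendsto_cong[OF eq] by (rule tendsto_unique[OF at_within_I[OF z]])
qed simp

text \<open>The last node is an evaluation point, all others are operators. If the pair ends the
  list, this is symmetry of a single slope; otherwise two slope operators commute.\<close>

lemma slope_diff_swap:
  assumes "smooth f" "x \<in> I" "y \<in> I" "set zs \<subseteq> I"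
  shows "sdiff f (x # y # zs) = sdiff f (y # x # zs)"
proof (cases "zs = []")
  case True
  then show ?thesis
    using assms slope_sym by (simp add: slope_diff_Cons)
next
  case False
  have "sdiff (slope y (slope x f)) zs = sdiff (slope x (slope y f)) zs"
    using slope_commute assms False by (intro slope_diff_cong) auto
  then show ?thesis
    using False by (simp add: slope_diff_Cons)
qed

text \<open>Induction on the number of nodes for all \<open>f\<close> at once, since a common head
  replaces \<open>f\<close> by its slope. If the heads differ, each tail is reordered to begin with
  the other head, and then the two heads are swapped.\<close>

lemma slope_diff_perm:
  assumes "smooth f" "set xs \<subseteq> I" "mset ys = mset xs"
  shows "sdiff f ys = sdiff f xs"
  using assms
proof (induction "length xs" arbitrary: f xs ys)
  case 0
  then show ?case by simp
next
  case (Suc n)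
  note f = Suc.prems(1)
  obtain x xs' where xs: "xs = x # xs'" "length xs' = n"
    using Suc.hyps(2) by (cases xs) auto
  obtain y ys' where ys: "ys = y # ys'"
    using Suc.prems(3) xs by (cases ys) simp_all
  have xI: "x \<in> I" "set xs' \<subseteq> I" using Suc.prems(2) xs by simp_all
  have "set ys \<subseteq> I" using Suc.prems(2) mset_eq_setD[OF Suc.prems(3)] by metis
  then have yI: "y \<in> I" "set ys' \<subseteq> I" using ys by simp_all
  have len: "length ys' = n"
    using mset_eq_length[OF Suc.prems(3)] xs ys by simp
  have IH: "sdiff f (u # vs) = sdiff f (u # us)"
    if "u \<in> I" "set us \<subseteq> I" "mset vs = mset us" "length us = n" for u us vs
  proof (cases "us = []")
    case True
    then show ?thesis using that(3) by simp
  next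
    case False
    then have vs: "vs \<noteq> []" using that(3) by auto
    have "sdiff (slope u f) vs = sdiff (slope u f) us"
      using that by (intro Suc.hyps(1) smooth_slope f) simp_all
    then show ?thesis
      by (simp only: slope_diff_Cons[OF False] slope_diff_Cons[OF vs])
  qed
  show ?case
  proof (cases "x = y")
    case True
    then show ?thesis
      unfolding xs(1) ys using xI Suc.prems(3) xs ys by (auto intro: IH)
  next
    case False
    have "add_mset y (mset ys') = add_mset x (mset xs')"
      using Suc.prems(3) xs ys by simp
    then obtain K where "mset ys' = add_mset x K" "mset xs' = add_mset y K"
      using False by (auto simp only: add_eq_conv_ex)
    moreover obtain zs where "mset zs = K" using ex_mset by blast
    ultimately have zs: "mset (y # zs) = mset xs'" "mset (x # zs) = mset ys'" by simp_all
    have "set (y # zs) \<subseteq> I" using mset_eq_setD[OF zs(1)] xI by metis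
    then have zI: "set zs \<subseteq> I" by simp
    have "sdiff f (x # xs') = sdiff f (x # y # zs)"
      using xI zs(1) xs(2) by (intro IH[symmetric]) simp_all
    also have "\<dots> = sdiff f (y # x # zs)"
      using f xI(1) yI(1) zI by (rule slope_diff_swap)
    also have "\<dots> = sdiff f (y # ys')"
      using yI zs(2) len by (intro IH) simp_all
    finally show ?thesis using xs ys by simp
  qed
qed

text \<open>The product vanishes at \<open>y\<close> and has derivative \<open>f y\<close> there, so
  its slope function at \<open>y\<close> is \<open>f\<close> on all of \<open>I\<close>. Symmetry
  moves \<open>y\<close> to the front, where that slope is taken first.\<close>

lemma slope_diff_cancel:
  assumes f: "smooth f" and xs: "set xs \<subseteq> I" "xs \<noteq> []" and y: "y \<in> I"
  shows "sdiff (\<lambda>x. gdet \<gamma>1 \<gamma>2 y x * f x) (xs @ [y]) = sdiff f xs"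
proof -
  let ?g = "\<lambda>x. gdet \<gamma>1 \<gamma>2 y x * f x"
  have l: "gdet \<gamma>1 \<gamma>2 y x = - \<tau> y + 1 * \<tau> x" if "x \<in> I" for x
    using y that by (simp add: gdet_eq)
  obtain F where F: "jet f F" using gsmooth_jet f by blast
  have "D ?g y = f y"
    using jet_gderiv[OF jet_affine_mult[OF F l] y, of 1] F y by (simp add: jet_def)
  then have slope: "slope y ?g x = f x" if "x \<in> I" for x
    using that y inj_onD[OF inj, of x y] by (auto simp: gslope_def gquot_def gdet_eq)
  have "sdiff ?g (xs @ [y]) = sdiff ?g (y # xs)"
    using smooth_affine_mult[OF f l] xs y by (intro slope_diff_perm) auto
  also have "\<dots> = sdiff f xs"
    unfolding slope_diff_Cons[OF xs(2)] using slope xs by (rule slope_diff_cong)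
  finally show ?thesis .
qed

text \<open>The \<open>n\<close>-th derivative at \<open>x\<close> of the slope at \<open>x\<close>
  is the next derivative of \<open>f\<close> divided by \<open>n + 1\<close>; the factorial
  accumulates.\<close>

lemma slope_diff_replicate:
  assumes "smooth f" "x \<in> I"
  shows "sdiff f (replicate (Suc n) x) = (D ^^ n) f x / fact n"
  using assms(1)
proof (induction n arbitrary: f)
  case (Suc n)
  obtain F where F: "jet f F" using gsmooth_jet Suc.prems by blast
  have "(D ^^ n) (slope x f) x = (D ^^ Suc n) f x / (real n + 1)"
    using jet_gderiv[OF jet_slope[OF F assms(2)] assms(2), of n]
      jet_gderiv[OF F assms(2), of "Suc n"] by (simp only: radial_mean_at_center)
  then show ?case
    using Suc.IH[OF smooth_slope[OF Suc.prems assms(2)]]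
    by (simp add: slope_diff_Cons add.commute mult.commute)
qed simp

section \<open>Existence and uniqueness of the divided difference\<close>

lemma is_divided_difference_slope_diff: "is_divided_difference I \<gamma>1 \<gamma>2 sdiff"
  unfolding is_divided_difference_def
  by (intro conjI allI ballI impI slope_diff_single slope_diff_recursion slope_diff_perm
      slope_diff_cancel slope_diff_replicate)

lemma is_divided_differenceD:
  assumes "is_divided_difference I \<gamma>1 \<gamma>2 dd"
  shows is_divided_difference_recursion: "set xs \<subseteq> I \<Longrightarrow> y \<in> I \<Longrightarrow> z \<in> I \<Longrightarrow> y \<noteq> z \<Longrightarrow>
      dd f (xs @ [y, z]) = (dd f (xs @ [z]) - dd f (xs @ [y])) / gdet \<gamma>1 \<gamma>2 y z"
    and is_divided_difference_perm:
      "smooth f \<Longrightarrow> set xs \<subseteq> I \<Longrightarrow> xs \<noteq> [] \<Longrightarrow> mset ys = mset xs \<Longrightarrow> dd f ys = dd f xs"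
    and is_divided_difference_replicate:
      "smooth f \<Longrightarrow> x \<in> I \<Longrightarrow> dd f (replicate (Suc n) x) = (D ^^ n) f x / fact n"
proof -
  note dd = assms[unfolded is_divided_difference_def]
  show "set xs \<subseteq> I \<Longrightarrow> y \<in> I \<Longrightarrow> z \<in> I \<Longrightarrow> y \<noteq> z \<Longrightarrow>
      dd f (xs @ [y, z]) = (dd f (xs @ [z]) - dd f (xs @ [y])) / gdet \<gamma>1 \<gamma>2 y z"
    by (rule dd[THEN conjunct2, THEN conjunct1, rule_format])
  show "smooth f \<Longrightarrow> set xs \<subseteq> I \<Longrightarrow> xs \<noteq> [] \<Longrightarrow> mset ys = mset xs \<Longrightarrow> dd f ys = dd f xs"
    by (rule dd[THEN conjunct2, THEN conjunct2, THEN conjunct1, rule_format])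
  show "smooth f \<Longrightarrow> x \<in> I \<Longrightarrow> dd f (replicate (Suc n) x) = (D ^^ n) f x / fact n"
    by (rule dd[THEN conjunct2, THEN conjunct2, THEN conjunct2, THEN conjunct2, rule_format])
qed

text \<open>Two distinct nodes can be moved to the end, where the recursion leads to shorter lists;
  if all nodes coincide, the differentiation property gives the value.\<close>

lemma is_divided_difference_unique:
  assumes dd: "is_divided_difference I \<gamma>1 \<gamma>2 dd" and dd': "is_divided_difference I \<gamma>1 \<gamma>2 dd'"
    and f: "smooth f" and E: "set E \<subseteq> I" "E \<noteq> []"
  shows "dd f E = dd' f E"
  using E
proof (induction "length E" arbitrary: E rule: less_induct)
  case less
  show ?case
  proof (cases "\<exists>y\<in>set E. \<exists>z\<in>set E. y \<noteq> z")
    case True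
    then obtain y z where yz: "y \<in> set E" "z \<in> set E" "y \<noteq> z" by blast
    obtain xs where xs: "mset xs = mset E - {#y, z#}" using ex_mset by blast
    have "{#y, z#} \<subseteq># mset E"
      using yz by (auto simp: insert_subset_eq_iff in_diff_count)
    then have E: "mset E = mset (xs @ [y, z])"
      using subset_mset.diff_add[of "{#y, z#}" "mset E"] xs by simp
    have sub: "set xs \<subseteq> I" "y \<in> I" "z \<in> I"
      using less.prems mset_eq_setD[OF E] by auto
    have "length E = length xs + 2"
      using mset_eq_length[OF E] by simp
    then have IH: "dd f (xs @ [w]) = dd' f (xs @ [w])" if "w \<in> I" for w
      using that sub by (intro less.hyps) auto
    have step: "d f E = (d f (xs @ [z]) - d f (xs @ [y])) / gdet \<gamma>1 \<gamma>2 y z"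
      if d: "is_divided_difference I \<gamma>1 \<gamma>2 d" for d
    proof -
      have "d f E = d f (xs @ [y, z])"
        using sub E by (intro is_divided_difference_perm[OF d f]) simp_all
      also have "\<dots> = (d f (xs @ [z]) - d f (xs @ [y])) / gdet \<gamma>1 \<gamma>2 y z"
        using d sub yz(3) by (rule is_divided_difference_recursion)
      finally show ?thesis .
    qed
    show ?thesis
      using step[OF dd] step[OF dd'] IH sub by simp
  next
    case False
    obtain x n where n: "length E = Suc n" and x: "x \<in> set E"
      using less.prems by (cases E) auto
    have E: "E = replicate (Suc n) x"
      using False x n by (intro replicate_eqI) auto
    have "x \<in> I" using x less.prems by blast
    then have all_eq: "d f E = (D ^^ n) f x / fact n" if "is_divided_difference I \<gamma>1 \<gamma>2 d" for d
      unfolding E using that f by (intro is_divided_difference_replicate)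
    show ?thesis
      using all_eq[OF dd] all_eq[OF dd'] by simp
  qed
qed

text \<open>The choice in \<open>divided_difference\<close> is harmless: \<open>sdiff\<close> is a
  witness, and all witnesses agree on smooth functions.\<close>

lemma divided_difference_eq:
  assumes "smooth f" "set E \<subseteq> I" "E \<noteq> []"
  shows "divided_difference I \<gamma>1 \<gamma>2 f E = sdiff f E"
  using is_divided_difference_unique[OF _ is_divided_difference_slope_diff assms]
    someI[of "is_divided_difference I \<gamma>1 \<gamma>2", OF is_divided_difference_slope_diff]
  by (simp add: divided_difference_def)

lemma slope_diff_add_scaled:
  assumes "smooth f" "smooth g" "set E \<subseteq> I" "E \<noteq> []"
  shows "sdiff (\<lambda>x. c * f x + d * g x) E = c * sdiff f E + d * sdiff g E"
  using assms
proof (induction E arbitrary: f g)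
  case (Cons x E)
  show ?case
  proof (cases "E = []")
    case False
    obtain F where F: "jet f F" using gsmooth_jet Cons.prems by blast
    obtain G where G: "jet g G" using gsmooth_jet Cons.prems by blast
    have x: "x \<in> I" using Cons.prems by simp
    have D: "D (\<lambda>x. c * f x + d * g x) x = c * D f x + d * D g x"
      using jet_gderiv[OF jet_add_scaled[OF F G] x, of 1] jet_gderiv[OF F x, of 1]
        jet_gderiv[OF G x, of 1] by simp
    have "slope x (\<lambda>x. c * f x + d * g x) = (\<lambda>y. c * slope x f y + d * slope x g y)"
      by (rule ext) (auto simp: gslope_def gquot_def D diff_divide_distrib add_divide_distrib algebra_simps)
    then show ?thesis
      using False Cons.prems Cons.IH smooth_slope by (simp add: slope_diff_Cons)
  qed simp
qed simp

text \<open>Such an \<open>f\<close> is a polynomial of degree less than \<open>n\<close> in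
  \<open>\<tau>\<close>. Each slope lowers the bound by one, as a mean of zero values is zero, so
  the zero function is left at the last node.\<close>

lemma slope_diff_eq_0:
  assumes "jet f F" "\<And>t. t \<in> J \<Longrightarrow> F n t = 0" "set E \<subseteq> I" "length E = Suc n"
  shows "sdiff f E = 0"
  using assms
proof (induction n arbitrary: f F E)
  case 0
  then obtain x where "E = [x]" by (auto simp: length_Suc_conv)
  with 0 show ?case by (auto simp: jet_def)
next
  case (Suc n)
  then obtain x E' where E: "E = x # E'" "length E' = Suc n" "x \<in> I" "set E' \<subseteq> I"
    by (cases E) auto
  have "radial_mean (F (Suc n)) n (\<tau> x) t = 0" if "t \<in> J" for t
  proof -
    have zero: "u ^ n * F (Suc n) (\<tau> x + u * (t - \<tau> x)) = 0" if "u \<in> {0..1}" for u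
      using segment_in_convex[OF convex_J _ \<open>t \<in> J\<close> that] E Suc.prems(2) by simp
    have "radial_mean (F (Suc n)) n (\<tau> x) t = integral {0..1::real} (\<lambda>_. 0)"
      unfolding radial_mean_def by (intro integral_cong zero)
    then show ?thesis by simp
  qed
  then have "sdiff (slope x f) E' = 0"
    using E by (intro Suc.IH[OF jet_slope[OF Suc.prems(1)]]) auto
  then show ?case
    using E slope_diff_Cons[of E'] by force
qed

end

section \<open>The blossom\<close>

definition blossom_factor :: "(real \<Rightarrow> real) \<Rightarrow> (real \<Rightarrow> real) \<Rightarrow> real \<times> real \<Rightarrow> real \<Rightarrow> real" where
  "blossom_factor \<gamma>1 \<gamma>2 p x = fst p * \<gamma>2 x - snd p * \<gamma>1 x"

definition blossom_kernel ::
  "(real \<Rightarrow> real) \<Rightarrow> (real \<Rightarrow> real) \<Rightarrow> (real \<times> real) list \<Rightarrow> (real \<Rightarrow> real) \<Rightarrow> real \<Rightarrow> real" where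
  "blossom_kernel \<gamma>1 \<gamma>2 X A x = (\<Prod>p\<leftarrow>X. blossom_factor \<gamma>1 \<gamma>2 p x) * A x"

lemma blossom_kernel_Nil [simp]: "blossom_kernel \<gamma>1 \<gamma>2 [] A = A"
  by (simp add: blossom_kernel_def fun_eq_iff)

lemma blossom_kernel_Cons:
  "blossom_kernel \<gamma>1 \<gamma>2 (p # X) A =
     (\<lambda>x. blossom_factor \<gamma>1 \<gamma>2 p x * blossom_kernel \<gamma>1 \<gamma>2 X A x)"
  by (simp add: blossom_kernel_def fun_eq_iff mult.assoc)

lemma prod_list_map_mset_eq:
  fixes f :: "'b \<Rightarrow> 'a::comm_monoid_mult"
  assumes "mset xs = mset ys"
  shows "(\<Prod>x\<leftarrow>xs. f x) = (\<Prod>x\<leftarrow>ys. f x)"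
  by (metis assms mset_map prod_mset_prod_list)

lemma blossom_kernel_perm:
  "mset X' = mset X \<Longrightarrow> blossom_kernel \<gamma>1 \<gamma>2 X' = blossom_kernel \<gamma>1 \<gamma>2 X"
  by (simp add: blossom_kernel_def fun_eq_iff prod_list_map_mset_eq[of X' X])

text \<open>Moving the replaced pair to the front isolates the only factor that contains
  \<open>p\<close>, as needed for linearity.\<close>

lemma blossom_kernel_update:
  assumes "i < length X"
  shows "blossom_kernel \<gamma>1 \<gamma>2 (X[i := p]) A =
    blossom_kernel \<gamma>1 \<gamma>2 (p # take i X @ drop (Suc i) X) A"
  using assms by (subst blossom_kernel_perm[of "X[i := p]"]) (auto simp: upd_conv_take_nth_drop)

lemma blossom_kernel_nth:
  "blossom_kernel \<gamma>1 \<gamma>2 X A x =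
     (\<Prod>i<length X. fst (X ! i) * \<gamma>2 x - snd (X ! i) * \<gamma>1 x) * A x"
  by (simp add: blossom_kernel_def prod.list_conv_set_nth blossom_factor_def atLeast0LessThan)

lemma blossom_factor_curve: "blossom_factor \<gamma>1 \<gamma>2 (curve \<gamma>1 \<gamma>2 y) x = gdet \<gamma>1 \<gamma>2 y x"
  by (simp add: blossom_factor_def curve_def gdet_def mult.commute)

context chart
begin

abbreviation kernel :: "(real \<times> real) list \<Rightarrow> (real \<Rightarrow> real) \<Rightarrow> real \<Rightarrow> real" where
  "kernel \<equiv> blossom_kernel \<gamma>1 \<gamma>2"

abbreviation point :: "real \<Rightarrow> real \<times> real" where "point \<equiv> curve \<gamma>1 \<gamma>2"

text \<open>This lets a node be recovered from its pair: equal points have determinant zero, hence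
  equal coordinates.\<close>

lemma curve_inj: "inj_on point I"
proof (rule inj_onI)
  fix x y assume xy: "x \<in> I" "y \<in> I" "point x = point y"
  then have "gdet \<gamma>1 \<gamma>2 x y = 0" by (simp add: curve_def gdet_def)
  with xy show "x = y" using gdet_eq inj by (auto dest: inj_onD)
qed

lemma blossom_factor_affine:
  "x \<in> I \<Longrightarrow> blossom_factor \<gamma>1 \<gamma>2 p x =
    (fst p * a2 - snd p * a1) + (fst p * b2 - snd p * b1) * \<tau> x"
  by (simp add: blossom_factor_def gamma1 gamma2 algebra_simps)

lemma smooth_kernel: "smooth A \<Longrightarrow> smooth (kernel X A)"
proof (induction X)
  case (Cons p X)
  then show ?case
    unfolding blossom_kernel_Cons by (intro smooth_affine_mult[OF _ blossom_factor_affine]) auto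
qed simp

text \<open>Each factor is affine in \<open>\<tau>\<close> and so raises by one the order from which
  all derivatives vanish.\<close>

lemma kernel_jet_vanishing:
  assumes "jet A F" "\<And>j t. r \<le> j \<Longrightarrow> t \<in> J \<Longrightarrow> F j t = 0"
  shows "\<exists>G. jet (kernel X A) G \<and> (\<forall>j\<ge>r + length X. \<forall>t\<in>J. G j t = 0)"
proof (induction X)
  case Nil
  then show ?case using assms by auto
next
  case (Cons p X)
  then obtain G where G: "jet (kernel X A) G" "\<forall>j\<ge>r + length X. \<forall>t\<in>J. G j t = 0" by blast
  show ?case
    unfolding blossom_kernel_Cons
    by (intro exI conjI, rule jet_affine_mult[OF G(1) blossom_factor_affine]) (use G(2) in auto)
qed

section \<open>Antiderivatives and independence of their choice\<close>

text \<open>Below order \<open>r\<close>, differentiability is part of \<open>gantideriv\<close>;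
  from order \<open>r\<close> on, the derivatives of \<open>A\<close> agree on \<open>I\<close> with
  those of \<open>H\<close>.\<close>

lemma gantideriv_gsmooth:
  assumes A: "gantideriv I \<gamma>1 \<gamma>2 r H A" and H: "smooth H"
  shows "smooth A" "x \<in> I \<Longrightarrow> (D ^^ (j + r)) A x = (D ^^ j) H x"
proof -
  have eq: "\<forall>x\<in>I. (D ^^ (j + r)) A x = (D ^^ j) H x" for j
  proof (induction j)
    case 0
    then show ?case using A by (simp add: gantideriv_def)
  next
    case (Suc j)
    then show ?case using gderiv_cong[of I "(D ^^ (j + r)) A" "(D ^^ j) H"] by simp
  qed
  then show "x \<in> I \<Longrightarrow> (D ^^ (j + r)) A x = (D ^^ j) H x" by blast
  have "gdifferentiable I \<gamma>1 \<gamma>2 ((D ^^ j) A)" for j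
  proof (cases "j < r")
    case True
    then show ?thesis using A by (simp add: gantideriv_def)
  next
    case False
    have "smooth ((D ^^ (j - r)) H)"
      using H unfolding gsmooth_def by (metis comp_apply funpow_add)
    then have "smooth ((D ^^ j) A)"
      using eq[of "j - r"] False by (auto intro: smooth_cong)
    then show ?thesis
      by (metis gsmooth_def funpow_0)
  qed
  then show "smooth A" by (simp add: gsmooth_def)
qed

lemma gantideriv_exists:
  assumes "smooth H"
  shows "\<exists>A. gantideriv I \<gamma>1 \<gamma>2 r H A"
proof -
  obtain F where F: "jet H F" using gsmooth_jet assms by blast
  obtain G where G: "deriv_seq J G" "G r = F 0"
    using deriv_seq_iterated_antiderivative[OF convex_J, of F r] F by (auto simp: jet_def)
  have "jet (\<lambda>x. G 0 (\<tau> x)) G" using G by (simp add: jet_def)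
  from jet_gderiv_gdifferentiable[OF this] have "gantideriv I \<gamma>1 \<gamma>2 r H (\<lambda>x. G 0 (\<tau> x))"
    using F G by (simp add: gantideriv_def jet_def)
  then show ?thesis by blast
qed

text \<open>Two antiderivatives differ by a polynomial of degree less than \<open>r\<close> in \<open>\<tau>\<close>; the kernel built
  from it has degree less than \<open>r + length X\<close>, which is annihilated by \<open>r + length X + 1\<close> nodes.\<close>

lemma slope_diff_kernel_unique:
  assumes A: "gantideriv I \<gamma>1 \<gamma>2 r H A" and B: "gantideriv I \<gamma>1 \<gamma>2 r H B" and H: "smooth H"
    and E: "set E \<subseteq> I" "length E = Suc (r + length X)"
  shows "sdiff (kernel X A) E = sdiff (kernel X B) E"
proof -
  let ?C = "\<lambda>x. 1 * A x + (- 1) * B x"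
  note smooth_A = gantideriv_gsmooth(1)[OF A H] and smooth_B = gantideriv_gsmooth(1)[OF B H]
  obtain F G where F: "jet A F" and G: "jet B G"
    using gsmooth_jet[OF smooth_A] gsmooth_jet[OF smooth_B] by blast
  have "F j (\<tau> x) = G j (\<tau> x)" if "r \<le> j" "x \<in> I" for j x
    using gantideriv_gsmooth(2)[OF A H that(2), of "j - r"]
      gantideriv_gsmooth(2)[OF B H that(2), of "j - r"]
      jet_gderiv[OF F that(2), of j] jet_gderiv[OF G that(2), of j] that(1) by simp
  then obtain K where K: "jet (kernel X ?C) K" "\<forall>j\<ge>r + length X. \<forall>t\<in>J. K j t = 0"
    using kernel_jet_vanishing[OF jet_add_scaled[OF F G, of 1 "- 1"], of r X] by auto
  have "kernel X ?C = (\<lambda>x. 1 * kernel X A x + (- 1) * kernel X B x)"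
    by (simp add: blossom_kernel_def fun_eq_iff algebra_simps)
  moreover have "sdiff (\<lambda>x. 1 * kernel X A x + (- 1) * kernel X B x) E =
      1 * sdiff (kernel X A) E + (- 1) * sdiff (kernel X B) E"
    using E by (intro slope_diff_add_scaled smooth_kernel smooth_A smooth_B) auto
  moreover have "sdiff (kernel X ?C) E = 0"
    using K(2) E by (intro slope_diff_eq_0[OF K(1), of "r + length X"]) auto
  ultimately show ?thesis by simp
qed

section \<open>The blossom properties of the formula\<close>

lemma slope_diff_kernel_cancel:
  assumes A: "smooth A" and y: "y \<in> I" and E: "set E \<subseteq> I" "E \<noteq> []"
  shows "sdiff (kernel (X @ [point y]) A) (E @ [y]) = sdiff (kernel X A) E"
proof -
  have "kernel (X @ [point y]) A = kernel (point y # X) A"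
    by (rule fun_cong[OF blossom_kernel_perm]) simp
  then show ?thesis
    using slope_diff_cancel[OF smooth_kernel[OF A] E y]
    by (simp add: blossom_kernel_Cons blossom_factor_curve)
qed

text \<open>Cancellation removes the \<open>m\<close> pairs one by one; what remains is
  \<open>A\<close> on \<open>r + 1\<close> equal nodes, that is its \<open>r\<close>-th derivative
  over \<open>r!\<close>.\<close>

lemma slope_diff_kernel_diagonal:
  assumes A: "gantideriv I \<gamma>1 \<gamma>2 r H A" and H: "smooth H" and x: "x \<in> I"
  shows "sdiff (kernel (replicate m (point x)) A) (replicate (Suc (r + m)) x) = H x / fact r"
proof (induction m)
  case 0
  then show ?case
    using slope_diff_replicate[OF gantideriv_gsmooth(1)[OF A H] x, of r] A x
    by (simp add: gantideriv_def)
next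
  case (Suc m)
  \<comment> \<open>Cancellation acts at the end of both lists, while \<open>replicate\<close>
    unfolds at the front.\<close>
  have snoc: "replicate (Suc j) y = replicate j y @ [y]" for j and y :: 'b
    by (simp add: replicate_append_same)
  have "sdiff (kernel (replicate (Suc m) (point x)) A) (replicate (Suc (r + Suc m)) x) =
      sdiff (kernel (replicate m (point x)) A) (replicate (Suc (r + m)) x)"
    unfolding snoc[of m] add_Suc_right snoc[of "Suc (r + m)"]
    using x by (intro slope_diff_kernel_cancel gantideriv_gsmooth(1)[OF A H]) auto
  then show ?case
    using Suc.IH by simp
qed

lemma linear_slope_diff_kernel:
  assumes A: "smooth A" and i: "i < length X" and E: "set E \<subseteq> I" "E \<noteq> []"
  shows "linear (\<lambda>p. sdiff (kernel (X[i := p]) A) E)"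
proof -
  have comb: "sdiff (kernel (X[i := s *\<^sub>R p + t *\<^sub>R q]) A) E =
      s * sdiff (kernel (X[i := p]) A) E + t * sdiff (kernel (X[i := q]) A) E" for s t p q
  proof -
    have "kernel (X[i := s *\<^sub>R p + t *\<^sub>R q]) A =
        (\<lambda>x. s * kernel (X[i := p]) A x + t * kernel (X[i := q]) A x)"
      using i by (simp add: blossom_kernel_update blossom_kernel_Cons fun_eq_iff
          blossom_factor_def algebra_simps)
    then show ?thesis
      using slope_diff_add_scaled[OF smooth_kernel[OF A] smooth_kernel[OF A] E] by simp
  qed
  show ?thesis
  proof (rule linearI)
    show "sdiff (kernel (X[i := p + q]) A) E =
        sdiff (kernel (X[i := p]) A) E + sdiff (kernel (X[i := q]) A) E" for p q
      using comb[of 1 p 1 q] by simp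
    show "sdiff (kernel (X[i := s *\<^sub>R p]) A) E = s *\<^sub>R sdiff (kernel (X[i := p]) A) E" for s p
      using comb[of s p 0 p] by simp
  qed
qed

lemma homogeneous_blossom_exists:
  assumes H: "smooth H" and k: "k < 0"
  shows "\<exists>h. is_homogeneous_blossom I \<gamma>1 \<gamma>2 k H h \<and>
    (\<forall>X E A. int (length X) - int (length E) = k \<longrightarrow> set E \<subseteq> I \<longrightarrow>
       gantideriv I \<gamma>1 \<gamma>2 (length E - length X - 1) H A \<longrightarrow>
       h X (map point E) = fact (length E - length X - 1) * sdiff (kernel X A) E)"
proof -
  \<comment> \<open>For all admissible lists \<open>n - m - 1\<close> is this same number, so one
    antiderivative \<open>A\<close> serves every \<open>m\<close> and \<open>n\<close>.\<close>
  define r where "r = nat (- k - 1)"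
  obtain A where A: "gantideriv I \<gamma>1 \<gamma>2 r H A" using gantideriv_exists[OF H] by blast
  note smoothA = gantideriv_gsmooth(1)[OF A H]
  define node where "node = inv_into I point"
  define h where "h X U = fact r * sdiff (kernel X A) (map node U)" for X U
  have node: "node (point x) = x" if "x \<in> I" for x
    using that curve_inj by (simp add: node_def)
  have nodes: "set (map node U) \<subseteq> I" if "set U \<subseteq> point ` I" for U
    using that node by auto
  have len: "length U = Suc (r + length X)" if "int (length X) - int (length U) = k"
    for X U :: "(real \<times> real) list"
    using that k by (simp add: r_def)
  have "is_homogeneous_blossom I \<gamma>1 \<gamma>2 k H h"
    unfolding is_homogeneous_blossom_def
  proof (intro conjI allI impI ballI)
    fix X U X' U' :: "(real \<times> real) list"
    assume U: "set U \<subseteq> point ` I" and perm: "mset X' = mset X" "mset U' = mset U"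
    have "sdiff (kernel X A) (map node U') = sdiff (kernel X A) (map node U)"
      using perm(2) by (intro slope_diff_perm smooth_kernel smoothA nodes U) simp
    then show "h X' U' = h X U"
      using blossom_kernel_perm[OF perm(1)] by (simp add: h_def)
  next
    fix X U :: "(real \<times> real) list" and i
    assume "int (length X) - int (length U) = k" "set U \<subseteq> point ` I" "i < length X"
    then have "linear (\<lambda>p. fact r *\<^sub>R sdiff (kernel (X[i := p]) A) (map node U))"
      using len[of X U] nodes[of U]
      by (intro linear_compose_scale_right linear_slope_diff_kernel smoothA) auto
    then show "linear (\<lambda>p. h (X[i := p]) U)"
      by (simp add: h_def)
  next
    fix X U :: "(real \<times> real) list" and q
    assume U: "int (length X) - int (length U) = k" "set U \<subseteq> point ` I" and "q \<in> point ` I"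
    then obtain y where y: "y \<in> I" "q = point y" by blast
    have "map node U \<noteq> []" using len[OF U(1)] by auto
    then show "h (X @ [q]) (U @ [q]) = h X U"
      using slope_diff_kernel_cancel[OF smoothA y(1) nodes[OF U(2)]] y node by (simp add: h_def)
  next
    fix m n x assume mn: "int m - int n = k" and x: "x \<in> I"
    have "n = Suc (r + m)" using mn k by (simp add: r_def)
    then show "h (replicate m (point x)) (replicate n (point x)) = H x"
      using slope_diff_kernel_diagonal[OF A H x, of m] node[OF x]
      by (simp add: h_def map_replicate del: replicate_Suc)
  qed
  moreover have "h X (map point E) = fact (length E - length X - 1) * sdiff (kernel X B) E"
    if X: "int (length X) - int (length E) = k" and E: "set E \<subseteq> I"
      and B: "gantideriv I \<gamma>1 \<gamma>2 (length E - length X - 1) H B" for X E B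
  proof -
    \<comment> \<open>This identifies the order of \<open>B\<close> with \<open>r\<close>, so that
      \<open>B\<close> may replace the fixed \<open>A\<close>.\<close>
    have "length E = Suc (r + length X)"
      using X k by (simp add: r_def)
    moreover have "map node (map point E) = E"
      using E node by (simp add: map_idI subset_iff)
    ultimately show ?thesis
      using slope_diff_kernel_unique[OF A _ H E] B by (simp add: h_def)
  qed
  ultimately show ?thesis by blast
qed

end

section \<open>From the span condition to a chart\<close>

theorem theorem4p6:
  fixes I :: "real set" and \<gamma>1 \<gamma>2 H :: "real \<Rightarrow> real" and k :: int
  assumes interval: "is_interval I"
    and cont: "continuous_on I \<gamma>1" "continuous_on I \<gamma>2"
    and lin_indep: "\<forall>a b. (\<forall>x\<in>I. a * \<gamma>1 x + b * \<gamma>2 x = 0) \<longrightarrow> a = 0 \<and> b = 0"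
    and nonvanishing: "\<forall>x\<in>I. \<forall>y\<in>I. x \<noteq> y \<longrightarrow> gdet \<gamma>1 \<gamma>2 x y \<noteq> 0"
    and one_in_span: "\<exists>a b. \<forall>x\<in>I. a * \<gamma>1 x + b * \<gamma>2 x = 1"
    and diff: "gsmooth I \<gamma>1 \<gamma>2 H"
    and neg: "k < 0"
  shows "\<exists>h. is_homogeneous_blossom I \<gamma>1 \<gamma>2 k H h \<and>
    (\<forall>m n (X :: (real \<times> real) list) (E :: real list) A.
       length X = m \<longrightarrow> length E = n \<longrightarrow> int m - int n = k \<longrightarrow> set E \<subseteq> I \<longrightarrow>
       gantideriv I \<gamma>1 \<gamma>2 (n - m - 1) H A \<longrightarrow>
       h X (map (curve \<gamma>1 \<gamma>2) E) =
         divided_difference I \<gamma>1 \<gamma>2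
           (\<lambda>x. fact (n - m - 1) *
                (\<Prod>i<m. fst (X ! i) * \<gamma>2 x - snd (X ! i) * \<gamma>1 x) * A x) E)"
proof -
  obtain a b where one: "\<And>x. x \<in> I \<Longrightarrow> a * \<gamma>1 x + b * \<gamma>2 x = 1"
    using one_in_span by blast
  have nonempty: "I \<noteq> {}" using lin_indep by auto
  define s where "s = a\<^sup>2 + b\<^sup>2"
  have "a \<noteq> 0 \<or> b \<noteq> 0" using nonempty one by fastforce
  then have s: "s \<noteq> 0" by (simp add: s_def sum_power2_eq_zero_iff)
  define \<tau> where "\<tau> x = (a * \<gamma>2 x - b * \<gamma>1 x) / s" for x
  have gdet: "gdet \<gamma>1 \<gamma>2 x y = \<tau> y - \<tau> x" if "x \<in> I" "y \<in> I" for x y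
  proof -
    \<comment> \<open>Each term is multiplied by a copy of 1 taken at the other point, which leaves
      an identity between polynomials.\<close>
    have "s * (\<tau> y - \<tau> x) = (a * \<gamma>2 y - b * \<gamma>1 y) * (a * \<gamma>1 x + b * \<gamma>2 x) -
        (a * \<gamma>2 x - b * \<gamma>1 x) * (a * \<gamma>1 y + b * \<gamma>2 y)"
      using s that by (simp add: \<tau>_def one field_simps)
    also have "\<dots> = s * gdet \<gamma>1 \<gamma>2 x y"
      by (simp add: s_def gdet_def algebra_simps power2_eq_square)
    finally show ?thesis using s by simp
  qed
  \<comment> \<open>The affine coefficients solve the system
    \<open>a * \<gamma>1 + b * \<gamma>2 = 1\<close> and
    \<open>a * \<gamma>2 - b * \<gamma>1 = s * \<tau>\<close> for \<open>\<gamma>1\<close> and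
    \<open>\<gamma>2\<close>.\<close>
  interpret chart I \<gamma>1 \<gamma>2 \<tau> "a / s" "- b" "b / s" a
  proof
    show "is_interval I" by (rule interval)
    show "I \<noteq> {x}" for x
    proof
      assume "I = {x}"
      \<comment> \<open>On a single point this relation always holds; independence would force both
        functions to vanish there, against the span condition.\<close>
      then have "\<forall>y\<in>I. \<gamma>2 x * \<gamma>1 y + (- \<gamma>1 x) * \<gamma>2 y = 0" by simp
      then have "\<gamma>1 x = 0 \<and> \<gamma>2 x = 0" using lin_indep by (metis neg_equal_0_iff_equal)
      then show False using one[of x] \<open>I = {x}\<close> by simp
    qed
    show "continuous_on I \<tau>"
      unfolding \<tau>_def using s by (intro continuous_intros cont) auto
    show "inj_on \<tau> I"
    proof (rule inj_onI, rule ccontr)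
      fix x y assume "x \<in> I" "y \<in> I" "\<tau> x = \<tau> y" "x \<noteq> y"
      then show False using nonvanishing gdet[of x y] by auto
    qed
    show "\<gamma>1 x = a / s + - b * \<tau> x" if "x \<in> I" for x
    proof -
      have "s * (a / s + - b * \<tau> x) = a * (a * \<gamma>1 x + b * \<gamma>2 x) - b * (a * \<gamma>2 x - b * \<gamma>1 x)"
        using s one[OF that] by (simp add: \<tau>_def field_simps)
      also have "\<dots> = s * \<gamma>1 x" by (simp add: s_def algebra_simps power2_eq_square)
      finally show ?thesis using s by simp
    qed
    show "\<gamma>2 x = b / s + a * \<tau> x" if "x \<in> I" for x
    proof -
      have "s * (b / s + a * \<tau> x) = b * (a * \<gamma>1 x + b * \<gamma>2 x) + a * (a * \<gamma>2 x - b * \<gamma>1 x)"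
        using s one[OF that] by (simp add: \<tau>_def field_simps)
      also have "\<dots> = s * \<gamma>2 x" by (simp add: s_def algebra_simps power2_eq_square)
      finally show ?thesis using s by simp
    qed
    show "a / s * a - b / s * - b = 1"
      using s by (simp add: field_simps) (simp add: s_def power2_eq_square)
  qed
  obtain h where h: "is_homogeneous_blossom I \<gamma>1 \<gamma>2 k H h"
    and hE: "\<And>X E A. int (length X) - int (length E) = k \<Longrightarrow> set E \<subseteq> I \<Longrightarrow>
       gantideriv I \<gamma>1 \<gamma>2 (length E - length X - 1) H A \<Longrightarrow>
       h X (map point E) = fact (length E - length X - 1) * sdiff (kernel X A) E"
    using homogeneous_blossom_exists[OF diff neg] by blast
  have "h X (map (curve \<gamma>1 \<gamma>2) E) = divided_difference I \<gamma>1 \<gamma>2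
       (\<lambda>x. fact (length E - length X - 1) *
          (\<Prod>i<length X. fst (X ! i) * \<gamma>2 x - snd (X ! i) * \<gamma>1 x) * A x) E"
    if X: "int (length X) - int (length E) = k" and E: "set E \<subseteq> I"
      and A: "gantideriv I \<gamma>1 \<gamma>2 (length E - length X - 1) H A"
    for X :: "(real \<times> real) list" and E :: "real list" and A
  proof -
    let ?f = "fact (length E - length X - 1) :: real"
    have "E \<noteq> []" using X neg by auto
    have smooth: "smooth (kernel X A)"
      using smooth_kernel gantideriv_gsmooth(1)[OF A diff] by blast
    \<comment> \<open>The zero summand turns the rules for linear combinations into rules for
      scaling by the factorial.\<close>
    have "divided_difference I \<gamma>1 \<gamma>2 (\<lambda>x. ?f * kernel X A x + 0 * kernel X A x) E =
        ?f * sdiff (kernel X A) E + 0 * sdiff (kernel X A) E"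
      using divided_difference_eq[OF smooth_add_scaled[OF smooth smooth] E \<open>E \<noteq> []\<close>, of ?f 0]
        slope_diff_add_scaled[OF smooth smooth E \<open>E \<noteq> []\<close>, of ?f 0] by simp
    then show ?thesis
      using hE[OF X E A] by (simp add: blossom_kernel_nth mult.assoc)
  qed
  with h show ?thesis by blast
qed

end
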